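(* Let $n \geq 3$ be an integer and let $s > 0$ be a real number. If $s \geq 1$, then for every entrywise non-negative $A \in \mathcal{M}_n^{+}$ with factor width at most $2$, the matrix $A^{\odot s}$ also has factor width at most $2$. Conversely, if $s < 1$ then there exists an entrywise non-negative $A \in \mathcal{M}_n^{+}$ with factor width $2$ for which $A^{\odot s}$ is not positive semidefinite.
   Context: $\mathcal{M}_n^{+}$ denotes the set of $n \times n$ positive semidefinite (symmetric) matrices. For an entrywise non-negative matrix $A$ and real $s>0$ (not necessarily an integer), $A^{\odot s}$ is the Hadamard (entrywise) power, with $(i,j)$-entry $a_{i,j}^s$. The factor width of a positive semidefinite matrix $A$ is the smallest positive integer $k$ such that $A = \sum_{j=1}^r \mathbf{v}_j\mathbf{v}_j^*$ for some $r$ and some vectors $\mathbf{v}_1,\ldots,\mathbf{v}_r$, each with at most $k$ non-zero entries (for real $A$ the value is the same whether the vectors are taken in $\mathbb{R}^n$ or $\mathbb{C}^n$). *)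

theory Defs
  imports "HOL-Analysis.Analysis" "HOL-Library.Extended_Nat"
begin

definition psd :: "real^'n^'n \<Rightarrow> bool" where
  "psd A \<longleftrightarrow> transpose A = A \<and> (\<forall>x. 0 \<le> x \<bullet> (A *v x))"

definition entrywise_nonneg :: "real^'n^'n \<Rightarrow> bool" where
  "entrywise_nonneg A \<longleftrightarrow> (\<forall>i j. 0 \<le> A $ i $ j)"

text \<open>For \<open>s > 0\<close> and non-negative entries this agrees with the usual power also at \<open>0\<close>,
  since \<open>0 powr s = 0\<close>.\<close>

definition hadamard_power :: "real^'n^'n \<Rightarrow> real \<Rightarrow> real^'n^'n" where
  "hadamard_power A s = (\<chi> i j. A $ i $ j powr s)"

definition outer :: "real^'n \<Rightarrow> real^'n^'n" where
  "outer v = (\<chi> i j. v $ i * v $ j)"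

definition sparse_decomposable :: "nat \<Rightarrow> real^'n^'n \<Rightarrow> bool" where
  "sparse_decomposable k A \<longleftrightarrow>
     (\<exists>(r::nat) (v :: nat \<Rightarrow> real^'n).
        (\<forall>j<r. card {i. v j $ i \<noteq> 0} \<le> k) \<and> A = (\<Sum>j<r. outer (v j)))"

text \<open>The infimum in \<^typ>\<open>enat\<close> of a non-empty set is its least element; the value \<open>\<infinity>\<close> occurs
  only if there is no decomposition at all, i.e. never for positive semidefinite matrices.\<close>

definition factor_width :: "real^'n^'n \<Rightarrow> enat" where
  "factor_width A = Inf {enat k | k. 1 \<le> k \<and> sparse_decomposable k A}"

lemma factor_width_le_iff:
  assumes "1 \<le> k"
  shows "factor_width A \<le> enat k \<longleftrightarrow> sparse_decomposable k A"
proof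
  let ?S = "{enat k | k. 1 \<le> k \<and> sparse_decomposable k A}"
  assume le: "factor_width A \<le> enat k"
  have "?S \<noteq> {}"
  proof
    assume "?S = {}"
    then have "factor_width A = \<infinity>"
      unfolding factor_width_def by (simp only: Inf_enat_def if_True simp_thms)
    then show False
      using le by simp
  qed
  then have "Inf ?S \<in> ?S"
    by (metis (lifting) Inf_enat_def LeastI ex_in_conv)
  then obtain m where m: "factor_width A = enat m" "sparse_decomposable m A"
    unfolding factor_width_def by blast
  then have "m \<le> k"
    using le by simp
  moreover obtain r :: nat and v where
      "\<forall>j<r. card {i. v j $ i \<noteq> 0} \<le> m" "A = (\<Sum>j<r. outer (v j))"
    using m(2) unfolding sparse_decomposable_def by blast
  ultimately show "sparse_decomposable k A"
    unfolding sparse_decomposable_def by (intro exI[of _ r] exI[of _ v]) force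
next
  assume "sparse_decomposable k A"
  then show "factor_width A \<le> enat k"
    unfolding factor_width_def using assms by (intro Inf_lower) auto
qed

lemma sparse_decomposable_imp_psd:
  assumes "sparse_decomposable k A"
  shows "psd A"
proof -
  obtain r :: nat and v where A: "A = (\<Sum>j<r. outer (v j))"
    using assms unfolding sparse_decomposable_def by blast
  have entry: "A $ i $ l = (\<Sum>j<r. v j $ i * v j $ l)" for i l
    by (simp add: A outer_def)
  have "x \<bullet> (A *v x) = (\<Sum>j<r. (v j \<bullet> x)\<^sup>2)" for x
  proof -
    have "x \<bullet> (A *v x) = (\<Sum>i\<in>UNIV. \<Sum>l\<in>UNIV. \<Sum>j<r. (v j $ i * x $ i) * (v j $ l * x $ l))"
      by (simp add: inner_vec_def matrix_vector_mult_def entry sum_distrib_left sum_distrib_right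
          mult_ac)
    also have "\<dots> = (\<Sum>j<r. \<Sum>i\<in>UNIV. \<Sum>l\<in>UNIV. (v j $ i * x $ i) * (v j $ l * x $ l))"
      by (simp add: sum.swap[of _ "{..<r}"])
    also have "\<dots> = (\<Sum>j<r. (v j \<bullet> x)\<^sup>2)"
      by (simp add: inner_vec_def power2_eq_square sum_product)
    finally show ?thesis .
  qed
  then show ?thesis
    by (auto simp: psd_def vec_eq_iff transpose_def entry mult.commute intro!: sum_nonneg)
qed

end

theory Submission
  imports Defs
begin

text \<open>A symmetric matrix with factor width at most two is a sum of positive semidefinite matrices
  supported on two-by-two principal blocks, so its diagonal can be shared out: row \<open>i\<close> gives the
  amount \<open>w i l\<close> of \<open>A $ i $ i\<close> to the block on \<open>{i, l}\<close>, and the block is positive semidefinite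
  exactly when \<open>(A $ i $ l)\<^sup>2 \<le> w i l * w l i\<close>. Conversely any such sharing yields a decomposition
  (\<open>sparse_decomposable_two_iff\<close>). This reformulation makes the case \<open>s \<ge> 1\<close> transparent:
  the weights \<open>w i l powr s\<close> serve for the Hadamard power, because the block condition is
  multiplicative and \<open>x \<mapsto> x powr s\<close> is superadditive on the non-negative reals
  (\<open>sum_powr_le_powr_sum\<close>), so that the shares of a row still fit into its diagonal entry.

  For \<open>s < 1\<close> superadditivity fails already for \<open>1 + 1\<close>. The sum of the all-ones blocks on
  \<open>{a, b}\<close> and on \<open>{b, c}\<close> has a \<open>2\<close> at the shared index \<open>b\<close>; its power has
  \<open>2 powr s < 2\<close> there and takes a negative value at \<open>e\<^sub>a - e\<^sub>b + e\<^sub>c\<close>.\<close>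

section \<open>Superadditivity of powers\<close>

text \<open>Each summand satisfies \<open>x powr s = x * x powr (s - 1) \<le> x * S powr (s - 1)\<close>,
  where \<open>S\<close> is the whole sum.\<close>

lemma sum_powr_le_powr_sum:
  fixes f :: "'a \<Rightarrow> real"
  assumes "finite I" and nonneg: "\<And>x. x \<in> I \<Longrightarrow> 0 \<le> f x" and "1 \<le> s"
  shows "(\<Sum>x\<in>I. f x powr s) \<le> (\<Sum>x\<in>I. f x) powr s"
proof -
  let ?S = "\<Sum>x\<in>I. f x"
  have split_off: "y powr s = y * y powr (s - 1)" if "0 \<le> y" for y :: real
    using powr_mult_base[OF that, of "s - 1"] by simp
  have "f x powr s \<le> f x * ?S powr (s - 1)" if "x \<in> I" for x
  proof -
    have "f x \<le> ?S"
      using assms that by (intro member_le_sum) auto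
    then have "f x powr (s - 1) \<le> ?S powr (s - 1)"
      using \<open>1 \<le> s\<close> nonneg[OF that] by (intro powr_mono2) auto
    then show ?thesis
      using nonneg[OF that] by (simp add: split_off mult_left_mono)
  qed
  then have "(\<Sum>x\<in>I. f x powr s) \<le> (\<Sum>x\<in>I. f x * ?S powr (s - 1))"
    by (rule sum_mono)
  also have "\<dots> = ?S powr s"
    using nonneg by (simp add: split_off sum_nonneg sum_distrib_right)
  finally show ?thesis .
qed

section \<open>Factor width two as a sharing of the diagonal\<close>

lemma sparse_decomposable_sum_outer:
  fixes v :: "'a \<Rightarrow> real^'n"
  assumes "finite I" and "\<And>x. x \<in> I \<Longrightarrow> card {i. v x $ i \<noteq> 0} \<le> k"
  shows "sparse_decomposable k (\<Sum>x\<in>I. outer (v x))"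
proof -
  obtain h where h: "bij_betw h {..<card I} I"
    using ex_bij_betw_nat_finite[OF \<open>finite I\<close>] by (auto simp: atLeast0LessThan)
  then have "(\<Sum>x\<in>I. outer (v x)) = (\<Sum>j<card I. outer (v (h j)))"
    by (intro sum.reindex_bij_betw[symmetric])
  moreover have "card {i. v (h j) $ i \<noteq> 0} \<le> k" if "j < card I" for j
    using assms(2) h that by (auto simp: bij_betw_def)
  ultimately show ?thesis
    unfolding sparse_decomposable_def by (intro exI[of _ "card I"] exI[of _ "v \<circ> h"]) simp
qed

text \<open>The share \<open>w i l\<close> collects the diagonal contributions at \<open>i\<close> of all vectors that are
  non-zero at \<open>l\<close>. A vector with at most two non-zero entries that is non-zero at \<open>i\<close> contributes
  to at most one share of row \<open>i\<close>, which bounds the row sum; the block condition is the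
  Cauchy--Schwarz inequality.\<close>

lemma sparse_decomposable_two_imp_shares:
  fixes A :: "real^'n^'n"
  assumes "sparse_decomposable 2 A"
  obtains w where "\<And>i l. 0 \<le> w i l"
    and "\<And>i. (\<Sum>l\<in>-{i}. w i l) \<le> A $ i $ i"
    and "\<And>i l. i \<noteq> l \<Longrightarrow> (A $ i $ l)\<^sup>2 \<le> w i l * w l i"
proof -
  obtain r :: nat and v :: "nat \<Rightarrow> real^'n" where
    sparse: "\<And>j. j < r \<Longrightarrow> card {i. v j $ i \<noteq> 0} \<le> 2" and A: "A = (\<Sum>j<r. outer (v j))"
    using assms unfolding sparse_decomposable_def by blast
  have entry: "A $ i $ l = (\<Sum>j<r. v j $ i * v j $ l)" for i l
    by (simp add: A outer_def)
  define x where "x i l j = (if v j $ l = 0 then 0 else v j $ i)" for i l j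
  define w where "w i l = (\<Sum>j<r. (x i l j)\<^sup>2)" for i l
  have "(\<Sum>l\<in>-{i}. w i l) \<le> A $ i $ i" for i
  proof -
    have "(\<Sum>l\<in>-{i}. (x i l j)\<^sup>2) \<le> v j $ i * v j $ i" if "j < r" for j
    proof (cases "v j $ i = 0")
      case True
      then have "x i l j = 0" for l
        by (simp add: x_def)
      with True show ?thesis
        by simp
    next
      case False
      let ?N = "{l. v j $ l \<noteq> 0}"
      have "(\<Sum>l\<in>-{i}. (x i l j)\<^sup>2) = (\<Sum>l\<in>?N - {i}. (v j $ i)\<^sup>2)"
        unfolding x_def by (intro sum.mono_neutral_cong_right) auto
      also have "\<dots> = real (card (?N - {i})) * (v j $ i)\<^sup>2"
        by simp
      also have "\<dots> \<le> 1 * (v j $ i)\<^sup>2"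
        using sparse[OF that] False by (intro mult_right_mono) (auto simp: card_Diff_singleton)
      finally show ?thesis
        by (simp add: power2_eq_square)
    qed
    then have "(\<Sum>j<r. \<Sum>l\<in>-{i}. (x i l j)\<^sup>2) \<le> A $ i $ i"
      unfolding entry by (intro sum_mono) simp
    then show ?thesis
      unfolding w_def by (simp add: sum.swap[of _ "{..<r}"])
  qed
  moreover have "(A $ i $ l)\<^sup>2 \<le> w i l * w l i" for i l
  proof -
    have "A $ i $ l = (\<Sum>j<r. x i l j * x l i j)"
      unfolding entry x_def by (intro sum.cong) auto
    then show ?thesis
      unfolding w_def by (simp add: Cauchy_Schwarz_ineq_sum)
  qed
  moreover have "0 \<le> w i l" for i l
    unfolding w_def by (simp add: sum_nonneg)
  ultimately show thesis
    using that by blast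
qed

text \<open>The vector with the entries \<open>sqrt (w i l)\<close> at \<open>i\<close> and \<open>A $ i $ l / sqrt (w i l)\<close> at \<open>l\<close>
  produces the off-diagonal entry \<open>A $ i $ l\<close> while using at most the shares \<open>w i l\<close> and
  \<open>w l i\<close> of the diagonal. Indices of type \<open>'n\<close> carry no order, so both ordered pairs
  \<open>(i, l)\<close> and \<open>(l, i)\<close> are used, each with weight one half. What remains on the diagonal is
  non-negative and is filled up by multiples of the unit vectors.\<close>

lemma shares_imp_sparse_decomposable_two:
  fixes A :: "real^'n^'n"
  assumes sym: "transpose A = A"
    and nonneg: "\<And>i l. 0 \<le> w i l"
    and row: "\<And>i. (\<Sum>l\<in>-{i}. w i l) \<le> A $ i $ i"
    and block: "\<And>i l. i \<noteq> l \<Longrightarrow> (A $ i $ l)\<^sup>2 \<le> w i l * w l i"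
  shows "sparse_decomposable 2 A"
proof -
  have A_sym: "A $ i $ l = A $ l $ i" for i l
    using sym by (metis transpose_def vec_lambda_beta)
  have used_le: "(A $ i $ l)\<^sup>2 / w i l \<le> w l i" if "i \<noteq> l" for i l
    using block[OF that] nonneg[of i l] nonneg[of l i]
    by (cases "w i l = 0") (auto simp: divide_le_eq mult.commute)
  have zero: "A $ i $ l = 0" if "i \<noteq> l" "w i l = 0" for i l
    using block[OF that(1)] that(2) by simp
  define rest where "rest i = A $ i $ i - (\<Sum>l\<in>-{i}. w i l / 2)
      - (\<Sum>l\<in>-{i}. (A $ l $ i)\<^sup>2 / w l i / 2)" for i
  have rest_nonneg: "0 \<le> rest i" for i
  proof -
    have "(\<Sum>l\<in>-{i}. (A $ l $ i)\<^sup>2 / w l i / 2) \<le> (\<Sum>l\<in>-{i}. w i l / 2)"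
      using used_le by (intro sum_mono divide_right_mono) auto
    then show ?thesis
      using row[of i] by (simp add: rest_def flip: sum_divide_distrib)
  qed
  \<comment> \<open>If \<open>w p q = 0\<close>, the entry at \<open>q\<close> is \<open>0\<close> by the convention for division by zero;
    this is the right value because then \<open>A $ p $ q = 0\<close>. The factors \<open>2\<close> under the roots
    are the weight one half, and the pairs \<open>(p, p)\<close> carry the remaining diagonal.\<close>
  define u :: "'n \<times> 'n \<Rightarrow> real^'n" where
    "u = (\<lambda>(p, q). \<chi> m.
       if p = q then (if m = p then sqrt (rest p) else 0)
       else if m = p then sqrt (w p q / 2)
       else if m = q then A $ p $ q / sqrt (2 * w p q) else 0)"
  have "card {m. u z $ m \<noteq> 0} \<le> 2" for z
  proof -
    obtain p q where z: "z = (p, q)"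
      by fastforce
    have "card {m. u z $ m \<noteq> 0} \<le> card {p, q}"
      by (intro card_mono) (auto simp: u_def z split: if_splits)
    also have "\<dots> \<le> 2"
      by (simp add: card_insert_if)
    finally show ?thesis .
  qed
  then have "sparse_decomposable 2 (\<Sum>z\<in>UNIV. outer (u z))"
    by (intro sparse_decomposable_sum_outer) auto
  moreover have "(\<Sum>z\<in>UNIV. outer (u z)) $ i $ l = A $ i $ l" for i l
  proof -
    have "(\<Sum>z\<in>UNIV. outer (u z)) $ i $ l = (\<Sum>p\<in>UNIV. \<Sum>q\<in>UNIV. u (p, q) $ i * u (p, q) $ l)"
      by (simp add: outer_def sum.cartesian_product UNIV_Times_UNIV[symmetric] case_prod_unfold
          del: UNIV_Times_UNIV)
    also have "\<dots> = A $ i $ l"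
    proof (cases "i = l")
      case True
      have "u (p, q) $ i * u (p, q) $ i =
          (if p = i then (if q = i then rest i else w i q / 2) else 0) +
          (if q = i then (if p = i then 0 else (A $ p $ i)\<^sup>2 / w p i / 2) else 0)" for p q
        using rest_nonneg[of i] nonneg[of i q] nonneg[of p i]
        by (auto simp: u_def power2_eq_square)
      then have "(\<Sum>q\<in>UNIV. u (p, q) $ i * u (p, q) $ i) =
          (if p = i then (\<Sum>q\<in>UNIV. if q = i then rest i else w i q / 2) else 0) +
          (if p = i then 0 else (A $ p $ i)\<^sup>2 / w p i / 2)" for p
        by (cases "p = i") simp_all
      then have "(\<Sum>p\<in>UNIV. \<Sum>q\<in>UNIV. u (p, q) $ i * u (p, q) $ i) =
          (\<Sum>p\<in>UNIV. if p = i then (\<Sum>q\<in>UNIV. if q = i then rest i else w i q / 2) else 0) +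
          (\<Sum>p\<in>UNIV. if p = i then 0 else (A $ p $ i)\<^sup>2 / w p i / 2)"
        by (simp only: sum.distrib)
      also have "\<dots> = (\<Sum>q\<in>UNIV. if q = i then rest i else w i q / 2) +
          (\<Sum>p\<in>UNIV. if p = i then 0 else (A $ p $ i)\<^sup>2 / w p i / 2)"
        by simp
      also have "\<dots> = rest i + (\<Sum>q\<in>-{i}. w i q / 2) + (\<Sum>p\<in>-{i}. (A $ p $ i)\<^sup>2 / w p i / 2)"
        by (simp add: sum.If_cases Compl_eq)
      also have "\<dots> = A $ i $ i"
        by (simp add: rest_def)
      finally show ?thesis
        using True by simp
    next
      case False
      have half: "sqrt (w p q / 2) * (A $ p $ q / sqrt (2 * w p q)) = A $ p $ q / 2"
        if "p \<noteq> q" for p q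
        using zero[OF that] nonneg[of p q]
        by (cases "w p q = 0") (auto simp: real_sqrt_divide real_sqrt_mult)
      have "u (p, q) $ i * u (p, q) $ l =
          (if p = i then (if q = l then A $ i $ l / 2 else 0) else 0) +
          (if p = l then (if q = i then A $ l $ i / 2 else 0) else 0)" for p q
        using False half[of i l] half[of l i] by (auto simp: u_def mult.commute)
      then have "(\<Sum>q\<in>UNIV. u (p, q) $ i * u (p, q) $ l) =
          (if p = i then A $ i $ l / 2 else 0) + (if p = l then A $ l $ i / 2 else 0)" for p
        using False by (cases "p = i"; cases "p = l") simp_all
      then show ?thesis
        using A_sym[of l i] by (simp add: sum.distrib)
    qed
    finally show ?thesis .
  qed
  ultimately show ?thesis
    by (metis (no_types, lifting) vec_eq_iff)
qed

lemma sparse_decomposable_two_iff: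
  fixes A :: "real^'n^'n"
  shows "sparse_decomposable 2 A \<longleftrightarrow> transpose A = A \<and>
    (\<exists>w. (\<forall>i l. 0 \<le> w i l) \<and> (\<forall>i. (\<Sum>l\<in>-{i}. w i l) \<le> A $ i $ i) \<and>
         (\<forall>i l. i \<noteq> l \<longrightarrow> (A $ i $ l)\<^sup>2 \<le> w i l * w l i))" (is "?L \<longleftrightarrow> ?R")
proof
  assume L: ?L
  then have "transpose A = A"
    using sparse_decomposable_imp_psd psd_def by blast
  with L show ?R
    by (metis sparse_decomposable_two_imp_shares)
next
  assume ?R
  then show ?L
    using shares_imp_sparse_decomposable_two by blast
qed

section \<open>Exponents at least one\<close>

lemma sparse_decomposable_two_hadamard_power:
  fixes A :: "real^'n^'n"
  assumes "entrywise_nonneg A" and "sparse_decomposable 2 A" and "1 \<le> s"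
  shows "sparse_decomposable 2 (hadamard_power A s)"
proof -
  have A_nonneg: "0 \<le> A $ i $ l" for i l
    using assms(1) by (simp add: entrywise_nonneg_def)
  obtain w where sym: "transpose A = A" and nonneg: "\<And>i l. 0 \<le> w i l"
    and row: "\<And>i. (\<Sum>l\<in>-{i}. w i l) \<le> A $ i $ i"
    and block: "\<And>i l. i \<noteq> l \<Longrightarrow> (A $ i $ l)\<^sup>2 \<le> w i l * w l i"
    using assms(2) unfolding sparse_decomposable_two_iff by blast
  show ?thesis
  proof (rule shares_imp_sparse_decomposable_two[where w = "\<lambda>i l. w i l powr s"])
    show "transpose (hadamard_power A s) = hadamard_power A s"
      using sym by (simp add: vec_eq_iff transpose_def hadamard_power_def)
    show "0 \<le> w i l powr s" for i l
      by simp
    show "(\<Sum>l\<in>-{i}. w i l powr s) \<le> hadamard_power A s $ i $ i" for i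
    proof -
      have "(\<Sum>l\<in>-{i}. w i l powr s) \<le> (\<Sum>l\<in>-{i}. w i l) powr s"
        using nonneg \<open>1 \<le> s\<close> by (intro sum_powr_le_powr_sum) auto
      also have "\<dots> \<le> A $ i $ i powr s"
        using row nonneg \<open>1 \<le> s\<close> by (intro powr_mono2) (auto intro: sum_nonneg)
      finally show ?thesis
        by (simp add: hadamard_power_def)
    qed
    show "(hadamard_power A s $ i $ l)\<^sup>2 \<le> w i l powr s * w l i powr s" if "i \<noteq> l" for i l
    proof -
      have "(A $ i $ l powr s)\<^sup>2 = (A $ i $ l)\<^sup>2 powr s"
        using A_nonneg by (simp add: power2_eq_square powr_mult)
      also have "\<dots> \<le> (w i l * w l i) powr s"
        using block[OF that] \<open>1 \<le> s\<close> by (intro powr_mono2) auto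
      also have "\<dots> = w i l powr s * w l i powr s"
        using nonneg by (simp add: powr_mult)
      finally show ?thesis
        by (simp add: hadamard_power_def)
    qed
  qed
qed

section \<open>Exponents below one\<close>

lemma sparse_decomposable_one_off_diagonal:
  fixes A :: "real^'n^'n"
  assumes "sparse_decomposable 1 A" and "i \<noteq> l"
  shows "A $ i $ l = 0"
proof -
  obtain r :: nat and v :: "nat \<Rightarrow> real^'n" where
    sparse: "\<And>j. j < r \<Longrightarrow> card {i. v j $ i \<noteq> 0} \<le> 1" and A: "A = (\<Sum>j<r. outer (v j))"
    using assms(1) unfolding sparse_decomposable_def by blast
  have "v j $ i * v j $ l = 0" if "j < r" for j
  proof (rule ccontr)
    assume "v j $ i * v j $ l \<noteq> 0"
    then have "card {i, l} \<le> card {i. v j $ i \<noteq> 0}"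
      by (intro card_mono) auto
    then show False
      using sparse[OF that] \<open>i \<noteq> l\<close> by simp
  qed
  then have "(\<Sum>j<r. v j $ i * v j $ l) = 0"
    by (intro sum.neutral) auto
  then show ?thesis
    by (simp add: A outer_def)
qed

lemma factor_width_eq_two_iff:
  "factor_width A = 2 \<longleftrightarrow> sparse_decomposable 2 A \<and> \<not> sparse_decomposable 1 A"
proof -
  have "factor_width A = 2 \<longleftrightarrow> factor_width A \<le> enat 2 \<and> \<not> factor_width A \<le> enat 1"
    by (cases "factor_width A") (auto simp: numeral_eq_enat)
  then show ?thesis
    by (simp add: factor_width_le_iff)
qed

text \<open>On the indices \<open>a, b, c\<close> the power is the matrix with rows \<open>(1, 1, 0)\<close>, \<open>(1, 2 powr s, 1)\<close>,
  \<open>(0, 1, 1)\<close>. The alternating vector collects all four off-diagonal ones with a negative sign,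
  so that its quadratic form is \<open>(1 + 2 powr s + 1) - 4\<close>.\<close>

lemma hadamard_power_not_psd_example:
  fixes a b c :: "'n::finite"
  assumes distinct: "a \<noteq> b" "b \<noteq> c" "a \<noteq> c" and "s < 1"
  defines "A \<equiv> outer (axis a 1 + axis b 1) + outer (axis b 1 + axis c 1) :: real^'n^'n"
  shows "entrywise_nonneg A" "psd A" "factor_width A = 2" "\<not> psd (hadamard_power A s)"
proof -
  have entry: "A $ i $ l = (if i \<in> {a, b} \<and> l \<in> {a, b} then 1 else 0) +
      (if i \<in> {b, c} \<and> l \<in> {b, c} then 1 else 0)" for i l
    using distinct by (auto simp: A_def outer_def axis_def)
  show "entrywise_nonneg A"
    by (simp add: entrywise_nonneg_def entry)
  have card_axis_sum: "card {m. (axis p 1 + axis q 1 :: real^'n) $ m \<noteq> 0} \<le> 2" for p q :: 'n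
  proof -
    have "card {m. (axis p 1 + axis q 1 :: real^'n) $ m \<noteq> 0} \<le> card {p, q}"
      by (intro card_mono) (auto simp: axis_def split: if_splits)
    also have "\<dots> \<le> 2"
      by (simp add: card_insert_if)
    finally show ?thesis .
  qed
  have "A = (\<Sum>p\<in>{a, c}. outer (axis p 1 + axis b 1))"
    using distinct by (simp add: A_def add.commute)
  then have sparse: "sparse_decomposable 2 A"
    using card_axis_sum by (auto intro!: sparse_decomposable_sum_outer)
  then show "psd A"
    by (rule sparse_decomposable_imp_psd)
  have "\<not> sparse_decomposable 1 A"
    using sparse_decomposable_one_off_diagonal[of A a b] distinct by (auto simp: entry)
  with sparse show "factor_width A = 2"
    by (simp add: factor_width_eq_two_iff)
  let ?x = "axis a 1 - axis b 1 + axis c 1 :: real^'n"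
  have quadratic: "?x \<bullet> (hadamard_power A s *v ?x) = 2 powr s - 2"
    using distinct
    by (simp add: matrix_vector_right_distrib matrix_vector_mult_diff_distrib
        matrix_vector_mult_basis column_def inner_add_left inner_diff_left inner_axis'
        hadamard_power_def entry)
  have "2 powr s < 2 powr (1 :: real)"
    using \<open>s < 1\<close> by (intro powr_less_mono) auto
  with quadratic have "?x \<bullet> (hadamard_power A s *v ?x) < 0"
    by simp
  then show "\<not> psd (hadamard_power A s)"
    unfolding psd_def by (meson not_less)
qed

section \<open>The threshold for factor width two\<close>

theorem theorem9:
  fixes s :: real
  assumes "CARD('n::finite) \<ge> 3" and "s > 0"
  shows "(s \<ge> 1 \<longrightarrow>
            (\<forall>A :: real^'n^'n. entrywise_nonneg A \<and> psd A \<and> factor_width A \<le> 2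
               \<longrightarrow> factor_width (hadamard_power A s) \<le> 2)) \<and>
         (s < 1 \<longrightarrow>
            (\<exists>A :: real^'n^'n. entrywise_nonneg A \<and> psd A \<and> factor_width A = 2
               \<and> \<not> psd (hadamard_power A s)))"
proof (intro conjI impI allI)
  fix A :: "real^'n^'n"
  assume "1 \<le> s" and "entrywise_nonneg A \<and> psd A \<and> factor_width A \<le> 2"
  then show "factor_width (hadamard_power A s) \<le> 2"
    using sparse_decomposable_two_hadamard_power[of A s]
    by (simp add: numeral_eq_enat factor_width_le_iff)
next
  assume "s < 1"
  obtain T :: "'n set" where "card T = 3"
    using obtain_subset_with_card_n[OF assms(1)] by blast
  then obtain a b c :: 'n where "a \<noteq> b" "b \<noteq> c" "a \<noteq> c"
    by (auto simp: card_3_iff)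
  then show "\<exists>A :: real^'n^'n. entrywise_nonneg A \<and> psd A \<and> factor_width A = 2
      \<and> \<not> psd (hadamard_power A s)"
    using hadamard_power_not_psd_example[of a b c s] \<open>s < 1\<close>
    by metis
qed

end
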